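(* Let $L$ be any of the fifteen logics of the modal cube. For every set of formulas $\Gamma$ and formula $\alpha$, if $\Gamma\vdash_L\alpha$ then $\Gamma\vDash^L\alpha$ (partial-semantic consequence).
   Context: Syntax and logics. Formulas: $\alpha ::= p \mid \bot \mid \alpha\to\alpha \mid \Box\alpha$; $\mathrm{For}$ is the set of formulas; $\neg\alpha:=\alpha\to\bot$, $\Diamond\alpha:=\neg\Box\neg\alpha$, $\wedge,\vee$ the usual classical abbreviations. $\mathbf K$: classical propositional axioms, (k) $\Box(\alpha\to\beta)\to(\Box\alpha\to\Box\beta)$, modus ponens, necessitation. Axiom schemes (D) $\Box\alpha\to\Diamond\alpha$, (T) $\Box\alpha\to\alpha$, (B) $\alpha\to\Box\Diamond\alpha$, (4) $\Box\alpha\to\Box\Box\alpha$, (5) $\Diamond\alpha\to\Box\Diamond\alpha$. The modal cube: $\mathbf K,\mathbf{KB},\mathbf{K4},\mathbf{K5},\mathbf{K45},\mathbf{KD},\mathbf{KDB},\mathbf{KD4},\mathbf{KD5},\mathbf{KD45},\mathbf{KT},\mathbf{KTB},\mathbf{S4}=\mathbf{KT4},\mathbf{S5}=\mathbf{KTB45},\mathbf{KB5}=\mathbf{KB45}$. $\Gamma\vdash_L\alpha$ means $\alpha$ or $(\gamma_1\wedge\dots\wedge\gamma_k)\to\alpha$ (some $\gamma_i\in\Gamma$) is a theorem of $L$. Truth values $\mathbf{F},\mathbf{f},\mathbf{f}_2,\mathbf{f}_3,\mathbf{t}_3,\mathbf{t}_2,\mathbf{t},\mathbf{T}$. Distinguished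 sets: $\mathcal D=\{\mathbf T,\mathbf t,\mathbf t_2,\mathbf t_3\}$ (designated), $N=\{\mathbf T,\mathbf t_2,\mathbf f_3,\mathbf f_2\}$, $I=\{\mathbf F,\mathbf f_2,\mathbf t_3,\mathbf t_2\}$, $P=\{\mathbf T,\mathbf t,\mathbf f_3,\mathbf f\}$, $PN=\{\mathbf F,\mathbf f,\mathbf t_3,\mathbf t\}$. Nmatrix $\mathcal M_L$. Values $V(L)$: all eight values for $\mathbf K,\mathbf{KB},\mathbf{K4},\mathbf{K5},\mathbf{K45}$; $\{\mathbf F,\mathbf f,\mathbf f_2,\mathbf t_2,\mathbf t,\mathbf T\}$ for $\mathbf{KB5}$; $\{\mathbf F,\mathbf f,\mathbf f_3,\mathbf t_3,\mathbf t,\mathbf T\}$ for $\mathbf{KD},\mathbf{KDB},\mathbf{KD4},\mathbf{KD5},\mathbf{KD45}$; $\{\mathbf F,\mathbf f,\mathbf t,\mathbf T\}$ for $\mathbf{KT},\mathbf{KTB},\mathbf{S4},\mathbf{S5}$. $\tilde\bot=\{\mathbf F,\mathbf f_2\}$. $\tilde\to(x,y)$, restricted to arguments in $V(L)$, listed for $y=\mathbf F,\mathbf f,\mathbf f_2,\mathbf f_3,\mathbf t_3,\mathbf t_2,\mathbf t,\mathbf T$: $x=\mathbf F$: $\{\mathbf T\}$ for all $y$; $x=\mathbf f$: $\{\mathbf t\},\{\mathbf T,\mathbf t\},\{\mathbf t_2\},\{\mathbf T\},\{\mathbf t\},\{\mathbf T\},\{\mathbf T,\mathbf t\},\{\mathbf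 T\}$; $x=\mathbf f_2$ and $x=\mathbf f_3$: $\{\mathbf t_3\},\{\mathbf t\},\{\mathbf t_2\},\{\mathbf T\},\{\mathbf t_3\},\{\mathbf t_2\},\{\mathbf t\},\{\mathbf T\}$; $x=\mathbf t_3$: $\{\mathbf f_3\}$ for $y\in\{\mathbf F,\mathbf f,\mathbf f_2,\mathbf f_3\}$, $\{\mathbf T\}$ otherwise; $x=\mathbf t_2$: $\{\mathbf F\},\{\mathbf f\},\{\mathbf f_2\},\{\mathbf f_3\},\{\mathbf t_3\},\{\mathbf t_2\},\{\mathbf t_3\},\{\mathbf T\}$; $x=\mathbf t$: $\{\mathbf f\},\{\mathbf f,\mathbf f_3\},\{\mathbf f_3\},\{\mathbf f_3\},\{\mathbf t\},\{\mathbf T\},\{\mathbf T,\mathbf t\},\{\mathbf T\}$; $x=\mathbf T$: $\{\mathbf F\},\{\mathbf f\},\{\mathbf f_2\},\{\mathbf f_3\},\{\mathbf t_3\},\{\mathbf t_2\},\{\mathbf t\},\{\mathbf T\}$. $\tilde\Box$ (argument $\mapsto$ output): $\mathbf K$: $\mathbf F,\mathbf f,\mathbf t_3,\mathbf t\mapsto\{\mathbf F,\mathbf f,\mathbf f_3\}$; $\mathbf f_2,\mathbf t_2\mapsto\{\mathbf t_2\}$; $\mathbf f_3,\mathbf T\mapsto\{\mathbf T,\mathbf t,\mathbf t_3\}$. $\mathbf{KB}$: $\mathbf F,\mathbf f\mapsto\{\mathbf F\}$; $\mathbf f_2,\mathbf t_2\mapsto\{\mathbf t_2\}$; $\mathbf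 f_3\mapsto\{\mathbf t_3\}$; $\mathbf t_3,\mathbf t\mapsto\{\mathbf F,\mathbf f,\mathbf f_3\}$; $\mathbf T\mapsto\{\mathbf T,\mathbf t,\mathbf t_3\}$. $\mathbf{K4}$: $\mathbf F,\mathbf f,\mathbf t_3,\mathbf t\mapsto\{\mathbf F,\mathbf f,\mathbf f_3\}$; $\mathbf f_2,\mathbf t_2\mapsto\{\mathbf t_2\}$; $\mathbf f_3,\mathbf T\mapsto\{\mathbf T\}$. $\mathbf{K5}$: $\mathbf F,\mathbf f,\mathbf t_3,\mathbf t\mapsto\{\mathbf F\}$; $\mathbf f_2,\mathbf t_2\mapsto\{\mathbf t_2\}$; $\mathbf f_3,\mathbf T\mapsto\{\mathbf T,\mathbf t_3\}$. $\mathbf{K45}$: $\mathbf F,\mathbf f,\mathbf t_3,\mathbf t\mapsto\{\mathbf F\}$; $\mathbf f_2,\mathbf t_2\mapsto\{\mathbf t_2\}$; $\mathbf f_3,\mathbf T\mapsto\{\mathbf T\}$. $\mathbf{KB5}$: $\mathbf F,\mathbf f,\mathbf t\mapsto\{\mathbf F\}$; $\mathbf f_2,\mathbf t_2\mapsto\{\mathbf t_2\}$; $\mathbf T\mapsto\{\mathbf T\}$. $\mathbf{KD}$: $\mathbf F,\mathbf f,\mathbf t_3,\mathbf t\mapsto\{\mathbf F,\mathbf f,\mathbf f_3\}$; $\mathbf f_3,\mathbf T\mapsto\{\mathbf T,\mathbf t,\mathbf t_3\}$. $\mathbf{KDB}$: $\mathbf F,\mathbf f\mapsto\{\mathbf F\}$;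 $\mathbf f_3\mapsto\{\mathbf t_3\}$; $\mathbf t_3,\mathbf t\mapsto\{\mathbf F,\mathbf f,\mathbf f_3\}$; $\mathbf T\mapsto\{\mathbf T,\mathbf t,\mathbf t_3\}$. $\mathbf{KD4}$: $\mathbf F,\mathbf t_3\mapsto\{\mathbf F\}$; $\mathbf f,\mathbf t\mapsto\{\mathbf F,\mathbf f,\mathbf f_3\}$; $\mathbf f_3,\mathbf T\mapsto\{\mathbf T\}$. $\mathbf{KD5}$: $\mathbf F,\mathbf f,\mathbf t_3,\mathbf t\mapsto\{\mathbf F\}$; $\mathbf f_3,\mathbf T\mapsto\{\mathbf T,\mathbf t_3\}$. $\mathbf{KD45}$: $\mathbf F,\mathbf f,\mathbf t_3,\mathbf t\mapsto\{\mathbf F\}$; $\mathbf f_3,\mathbf T\mapsto\{\mathbf T\}$. $\mathbf{KT}$: $\mathbf F\mapsto\{\mathbf F\}$; $\mathbf f,\mathbf t\mapsto\{\mathbf F,\mathbf f\}$; $\mathbf T\mapsto\{\mathbf T,\mathbf t\}$. $\mathbf{KTB}$: $\mathbf F,\mathbf f\mapsto\{\mathbf F\}$; $\mathbf t\mapsto\{\mathbf F,\mathbf f\}$; $\mathbf T\mapsto\{\mathbf T,\mathbf t\}$. $\mathbf{S4}$: $\mathbf F\mapsto\{\mathbf F\}$; $\mathbf f,\mathbf t\mapsto\{\mathbf F,\mathbf f\}$; $\mathbf T\mapsto\{\mathbf T\}$. $\mathbf{S5}$: $\mathbf F,\mathbf f,\mathbf t\mapsto\{\mathbf F\}$; $\mathbf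 T\mapsto\{\mathbf T\}$. Partial valuations: for $\Lambda$ closed under subformulas, $[\Lambda\to V]_{\mathcal M_L}$ is the set of maps $v:\Lambda\to V(L)$ with $v(\bot)\in\tilde\bot$, $v(\beta\to\gamma)\in\tilde\to(v(\beta),v(\gamma))$, $v(\Box\beta)\in\tilde\Box(v(\beta))$ whenever these formulas lie in $\Lambda$. Models: a pre-model on $\Lambda$ is a pair $\langle\Pi,R\rangle$ with $\Pi\subseteq[\Lambda\to V]_{\mathcal M_L}$ and $R\subseteq\Pi\times\Pi$ such that for all $v\in\Pi$, $\beta\in\Lambda$: if $v(\beta)\in P$ there is $w\in\Pi$ with $vRw$ and $w(\beta)\in\mathcal D$; if $v(\beta)\in PN$ there is $w\in\Pi$ with $vRw$ and $w(\beta)\notin\mathcal D$. A $\mathbf K$-model is a pre-model such that whenever $vRw$: $v(\beta)\in N\Rightarrow w(\beta)\in\mathcal D$ and $v(\beta)\in I\Rightarrow w(\beta)\notin\mathcal D$. An $L$-model is a $\mathbf K$-model satisfying, for each axiom scheme among (T),(D),(B),(4),(5) that holds in $L$, the following conditions for all $v,w,w'\in\Pi$, $\beta\in\Lambda$: (T): $v(\beta)\in N\Rightarrow v(\beta)\in\mathcal D$, and $v(\beta)\in I\Rightarrow v(\beta)\notin\mathcal D$; (D): $v(\beta)\in N\Rightarrow v(\beta)\in P$, and $v(\beta)\in I\Rightarrow v(\beta)\in PN$; (B): if $vRw$, then $v(\beta)\in\mathcal D\Rightarrow w(\beta)\in P$ and $v(\beta)\notin\mathcal D\Rightarrow w(\beta)\in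 PN$; (4): if $vRw$, then $v(\beta)\in N\Rightarrow w(\beta)\in N$ and $v(\beta)\in I\Rightarrow w(\beta)\in I$; (5): if $vRw$, then $v(\beta)\in P\Rightarrow w(\beta)\in P$ and $v(\beta)\in PN\Rightarrow w(\beta)\in PN$; moreover if $v(\beta),w(\beta)\in N$, $vRw$ and ($vRw'$ or $wRw'$) then $w'(\beta)\in N$, and likewise with $I$ in place of $N$. A partial valuation $v$ is a partial level-valuation (for $L$) if $v\in\Pi$ for some $L$-model $\langle\Pi,R\rangle$. Partial-semantic consequence: writing $\overline{\Gamma\cup\{\alpha\}}$ for the smallest set containing $\Gamma\cup\{\alpha\}$ closed under subformulas, $\Gamma\vDash^L\alpha$ holds iff for every partial level-valuation $v$ with domain $\overline{\Gamma\cup\{\alpha\}}$: if $v(\beta)\in\mathcal D$ for all $\beta\in\Gamma$ then $v(\alpha)\in\mathcal D$. *)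

theory Defs
  imports Main "HOL-Library.FuncSet" "HOL.Hull"
begin

section \<open>Formulas and logics\<close>

datatype 'p fm =
    Var 'p
  | Fls  (\<open>\<^bold>\<bottom>\<close>)
  | Imp "'p fm" "'p fm"  (infixr \<open>\<^bold>\<rightarrow>\<close> 65)
  | Box "'p fm"  (\<open>\<^bold>\<box> _\<close> [80] 80)

abbreviation Neg :: "'p fm \<Rightarrow> 'p fm"  (\<open>\<^bold>\<not> _\<close> [80] 80) where
  "\<^bold>\<not> \<alpha> \<equiv> \<alpha> \<^bold>\<rightarrow> \<^bold>\<bottom>"

abbreviation Dia :: "'p fm \<Rightarrow> 'p fm"  (\<open>\<^bold>\<diamond> _\<close> [80] 80) where
  "\<^bold>\<diamond> \<alpha> \<equiv> \<^bold>\<not> \<^bold>\<box> \<^bold>\<not> \<alpha>"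

abbreviation Conj :: "'p fm \<Rightarrow> 'p fm \<Rightarrow> 'p fm"  (infixr \<open>\<^bold>\<and>\<close> 75) where
  "\<alpha> \<^bold>\<and> \<beta> \<equiv> \<^bold>\<not> (\<alpha> \<^bold>\<rightarrow> \<^bold>\<not> \<beta>)"

text \<open>Only used for nonempty lists.\<close>

fun Conjs :: "'p fm list \<Rightarrow> 'p fm" where
  "Conjs [] = \<^bold>\<not> \<^bold>\<bottom>"
| "Conjs [\<gamma>] = \<gamma>"
| "Conjs (\<gamma> # \<gamma>s) = \<gamma> \<^bold>\<and> Conjs \<gamma>s"

fun subfms :: "'p fm \<Rightarrow> 'p fm set" where
  "subfms (Var p) = {Var p}"
| "subfms \<^bold>\<bottom> = {\<^bold>\<bottom>}"
| "subfms (\<alpha> \<^bold>\<rightarrow> \<beta>) = {\<alpha> \<^bold>\<rightarrow> \<beta>} \<union> subfms \<alpha> \<union> subfms \<beta>"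
| "subfms (\<^bold>\<box> \<alpha>) = {\<^bold>\<box> \<alpha>} \<union> subfms \<alpha>"

definition subfm_closed :: "'p fm set \<Rightarrow> bool" where
  "subfm_closed \<Lambda> \<longleftrightarrow> (\<forall>\<beta>\<in>\<Lambda>. subfms \<beta> \<subseteq> \<Lambda>)"

datatype scheme = Ax_D | Ax_T | Ax_B | Ax_4 | Ax_5

fun scheme_inst :: "scheme \<Rightarrow> 'p fm \<Rightarrow> 'p fm" where
  "scheme_inst Ax_D \<alpha> = \<^bold>\<box> \<alpha> \<^bold>\<rightarrow> \<^bold>\<diamond> \<alpha>"
| "scheme_inst Ax_T \<alpha> = \<^bold>\<box> \<alpha> \<^bold>\<rightarrow> \<alpha>"
| "scheme_inst Ax_B \<alpha> = \<alpha> \<^bold>\<rightarrow> \<^bold>\<box> \<^bold>\<diamond> \<alpha>"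
| "scheme_inst Ax_4 \<alpha> = \<^bold>\<box> \<alpha> \<^bold>\<rightarrow> \<^bold>\<box> \<^bold>\<box> \<alpha>"
| "scheme_inst Ax_5 \<alpha> = \<^bold>\<diamond> \<alpha> \<^bold>\<rightarrow> \<^bold>\<box> \<^bold>\<diamond> \<alpha>"

datatype modal_logic =
  K | KB | K4 | K5 | K45 | KD | KDB | KD4 | KD5 | KD45 | KT | KTB | S4 | S5 | KB5

fun schemes :: "modal_logic \<Rightarrow> scheme set" where
  "schemes K = {}"
| "schemes KB = {Ax_B}"
| "schemes K4 = {Ax_4}"
| "schemes K5 = {Ax_5}"
| "schemes K45 = {Ax_4, Ax_5}"
| "schemes KD = {Ax_D}"
| "schemes KDB = {Ax_D, Ax_B}"
| "schemes KD4 = {Ax_D, Ax_4}"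
| "schemes KD5 = {Ax_D, Ax_5}"
| "schemes KD45 = {Ax_D, Ax_4, Ax_5}"
| "schemes KT = {Ax_T}"
| "schemes KTB = {Ax_T, Ax_B}"
| "schemes S4 = {Ax_T, Ax_4}"
| "schemes S5 = {Ax_T, Ax_B, Ax_4, Ax_5}"
| "schemes KB5 = {Ax_B, Ax_4, Ax_5}"

inductive provable :: "modal_logic \<Rightarrow> 'p fm \<Rightarrow> bool" for L :: modal_logic where
  prop1: "provable L (\<alpha> \<^bold>\<rightarrow> \<beta> \<^bold>\<rightarrow> \<alpha>)"
| prop2: "provable L ((\<alpha> \<^bold>\<rightarrow> \<beta> \<^bold>\<rightarrow> \<gamma>) \<^bold>\<rightarrow> (\<alpha> \<^bold>\<rightarrow> \<beta>) \<^bold>\<rightarrow> \<alpha> \<^bold>\<rightarrow> \<gamma>)"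
| prop3: "provable L (\<^bold>\<not> \<^bold>\<not> \<alpha> \<^bold>\<rightarrow> \<alpha>)"
| axk: "provable L (\<^bold>\<box> (\<alpha> \<^bold>\<rightarrow> \<beta>) \<^bold>\<rightarrow> \<^bold>\<box> \<alpha> \<^bold>\<rightarrow> \<^bold>\<box> \<beta>)"
| ax: "X \<in> schemes L \<Longrightarrow> provable L (scheme_inst X \<alpha>)"
| mp: "provable L (\<alpha> \<^bold>\<rightarrow> \<beta>) \<Longrightarrow> provable L \<alpha> \<Longrightarrow> provable L \<beta>"
| nec: "provable L \<alpha> \<Longrightarrow> provable L (\<^bold>\<box> \<alpha>)"

text \<open>Premises are used locally: necessitation applies to theorems only.\<close>

definition derivable :: "'p fm set \<Rightarrow> modal_logic \<Rightarrow> 'p fm \<Rightarrow> bool"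
    (\<open>_ \<turnstile>\<^bsub>_\<^esub> _\<close> [51, 0, 51] 50) where
  "\<Gamma> \<turnstile>\<^bsub>L\<^esub> \<alpha> \<longleftrightarrow>
     provable L \<alpha> \<or>
     (\<exists>\<gamma>s. \<gamma>s \<noteq> [] \<and> set \<gamma>s \<subseteq> \<Gamma> \<and> provable L (Conjs \<gamma>s \<^bold>\<rightarrow> \<alpha>))"

section \<open>Nmatrices\<close>

datatype tv =
    VF  (\<open>\<^bold>F\<close>)
  | Vf  (\<open>\<^bold>f\<close>)
  | Vf2  (\<open>\<^bold>f\<^sub>2\<close>)
  | Vf3  (\<open>\<^bold>f\<^sub>3\<close>)
  | Vt3  (\<open>\<^bold>t\<^sub>3\<close>)
  | Vt2  (\<open>\<^bold>t\<^sub>2\<close>)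
  | Vt  (\<open>\<^bold>t\<close>)
  | VT  (\<open>\<^bold>T\<close>)

definition tvD :: "tv set" where "tvD = {\<^bold>T, \<^bold>t, \<^bold>t\<^sub>2, \<^bold>t\<^sub>3}"
definition tvN :: "tv set" where "tvN = {\<^bold>T, \<^bold>t\<^sub>2, \<^bold>f\<^sub>3, \<^bold>f\<^sub>2}"
definition tvI :: "tv set" where "tvI = {\<^bold>F, \<^bold>f\<^sub>2, \<^bold>t\<^sub>3, \<^bold>t\<^sub>2}"
definition tvP :: "tv set" where "tvP = {\<^bold>T, \<^bold>t, \<^bold>f\<^sub>3, \<^bold>f}"
definition tvPN :: "tv set" where "tvPN = {\<^bold>F, \<^bold>f, \<^bold>t\<^sub>3, \<^bold>t}"

definition values_of :: "modal_logic \<Rightarrow> tv set" where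
  "values_of L =
     (if L \<in> {K, KB, K4, K5, K45} then UNIV
      else if L = KB5 then {\<^bold>F, \<^bold>f, \<^bold>f\<^sub>2, \<^bold>t\<^sub>2, \<^bold>t, \<^bold>T}
      else if L \<in> {KD, KDB, KD4, KD5, KD45} then {\<^bold>F, \<^bold>f, \<^bold>f\<^sub>3, \<^bold>t\<^sub>3, \<^bold>t, \<^bold>T}
      else {\<^bold>F, \<^bold>f, \<^bold>t, \<^bold>T})"

definition fls_tv :: "tv set" where "fls_tv = {\<^bold>F, \<^bold>f\<^sub>2}"

text \<open>
  The arguments of \<^const>\<open>case_tv\<close> are the table entries for the columns
  \<open>\<^bold>F, \<^bold>f, \<^bold>f\<^sub>2, \<^bold>f\<^sub>3, \<^bold>t\<^sub>3, \<^bold>t\<^sub>2, \<^bold>t, \<^bold>T\<close>, in this order.  One table for the implication serves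
  all logics: valuations range over \<^const>\<open>values_of\<close>, so neither arguments nor results
  outside that set play a role.
\<close>

fun imp_tv :: "tv \<Rightarrow> tv \<Rightarrow> tv set" where
  "imp_tv \<^bold>F  = (\<lambda>y. {\<^bold>T})"
| "imp_tv \<^bold>f  = case_tv {\<^bold>t} {\<^bold>T, \<^bold>t} {\<^bold>t\<^sub>2} {\<^bold>T} {\<^bold>t} {\<^bold>T} {\<^bold>T, \<^bold>t} {\<^bold>T}"
| "imp_tv \<^bold>f\<^sub>2 = case_tv {\<^bold>t\<^sub>3} {\<^bold>t} {\<^bold>t\<^sub>2} {\<^bold>T} {\<^bold>t\<^sub>3} {\<^bold>t\<^sub>2} {\<^bold>t} {\<^bold>T}"
| "imp_tv \<^bold>f\<^sub>3 = case_tv {\<^bold>t\<^sub>3} {\<^bold>t} {\<^bold>t\<^sub>2} {\<^bold>T} {\<^bold>t\<^sub>3} {\<^bold>t\<^sub>2} {\<^bold>t} {\<^bold>T}"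
| "imp_tv \<^bold>t\<^sub>3 = case_tv {\<^bold>f\<^sub>3} {\<^bold>f\<^sub>3} {\<^bold>f\<^sub>3} {\<^bold>f\<^sub>3} {\<^bold>T} {\<^bold>T} {\<^bold>T} {\<^bold>T}"
| "imp_tv \<^bold>t\<^sub>2 = case_tv {\<^bold>F} {\<^bold>f} {\<^bold>f\<^sub>2} {\<^bold>f\<^sub>3} {\<^bold>t\<^sub>3} {\<^bold>t\<^sub>2} {\<^bold>t\<^sub>3} {\<^bold>T}"
| "imp_tv \<^bold>t  = case_tv {\<^bold>f} {\<^bold>f, \<^bold>f\<^sub>3} {\<^bold>f\<^sub>3} {\<^bold>f\<^sub>3} {\<^bold>t} {\<^bold>T} {\<^bold>T, \<^bold>t} {\<^bold>T}"
| "imp_tv \<^bold>T  = case_tv {\<^bold>F} {\<^bold>f} {\<^bold>f\<^sub>2} {\<^bold>f\<^sub>3} {\<^bold>t\<^sub>3} {\<^bold>t\<^sub>2} {\<^bold>t} {\<^bold>T}"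

text \<open>The entry is empty exactly when the argument is not a value of the logic.\<close>

fun box_tv :: "modal_logic \<Rightarrow> tv \<Rightarrow> tv set" where
  "box_tv K = case_tv {\<^bold>F, \<^bold>f, \<^bold>f\<^sub>3} {\<^bold>F, \<^bold>f, \<^bold>f\<^sub>3} {\<^bold>t\<^sub>2} {\<^bold>T, \<^bold>t, \<^bold>t\<^sub>3} {\<^bold>F, \<^bold>f, \<^bold>f\<^sub>3} {\<^bold>t\<^sub>2} {\<^bold>F, \<^bold>f, \<^bold>f\<^sub>3} {\<^bold>T, \<^bold>t, \<^bold>t\<^sub>3}"
| "box_tv KB = case_tv {\<^bold>F} {\<^bold>F} {\<^bold>t\<^sub>2} {\<^bold>t\<^sub>3} {\<^bold>F, \<^bold>f, \<^bold>f\<^sub>3} {\<^bold>t\<^sub>2} {\<^bold>F, \<^bold>f, \<^bold>f\<^sub>3} {\<^bold>T, \<^bold>t, \<^bold>t\<^sub>3}"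
| "box_tv K4 = case_tv {\<^bold>F, \<^bold>f, \<^bold>f\<^sub>3} {\<^bold>F, \<^bold>f, \<^bold>f\<^sub>3} {\<^bold>t\<^sub>2} {\<^bold>T} {\<^bold>F, \<^bold>f, \<^bold>f\<^sub>3} {\<^bold>t\<^sub>2} {\<^bold>F, \<^bold>f, \<^bold>f\<^sub>3} {\<^bold>T}"
| "box_tv K5 = case_tv {\<^bold>F} {\<^bold>F} {\<^bold>t\<^sub>2} {\<^bold>T, \<^bold>t\<^sub>3} {\<^bold>F} {\<^bold>t\<^sub>2} {\<^bold>F} {\<^bold>T, \<^bold>t\<^sub>3}"
| "box_tv K45 = case_tv {\<^bold>F} {\<^bold>F} {\<^bold>t\<^sub>2} {\<^bold>T} {\<^bold>F} {\<^bold>t\<^sub>2} {\<^bold>F} {\<^bold>T}"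
| "box_tv KB5 = case_tv {\<^bold>F} {\<^bold>F} {\<^bold>t\<^sub>2} {} {} {\<^bold>t\<^sub>2} {\<^bold>F} {\<^bold>T}"
| "box_tv KD = case_tv {\<^bold>F, \<^bold>f, \<^bold>f\<^sub>3} {\<^bold>F, \<^bold>f, \<^bold>f\<^sub>3} {} {\<^bold>T, \<^bold>t, \<^bold>t\<^sub>3} {\<^bold>F, \<^bold>f, \<^bold>f\<^sub>3} {} {\<^bold>F, \<^bold>f, \<^bold>f\<^sub>3} {\<^bold>T, \<^bold>t, \<^bold>t\<^sub>3}"
| "box_tv KDB = case_tv {\<^bold>F} {\<^bold>F} {} {\<^bold>t\<^sub>3} {\<^bold>F, \<^bold>f, \<^bold>f\<^sub>3} {} {\<^bold>F, \<^bold>f, \<^bold>f\<^sub>3} {\<^bold>T, \<^bold>t, \<^bold>t\<^sub>3}"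
| "box_tv KD4 = case_tv {\<^bold>F} {\<^bold>F, \<^bold>f, \<^bold>f\<^sub>3} {} {\<^bold>T} {\<^bold>F} {} {\<^bold>F, \<^bold>f, \<^bold>f\<^sub>3} {\<^bold>T}"
| "box_tv KD5 = case_tv {\<^bold>F} {\<^bold>F} {} {\<^bold>T, \<^bold>t\<^sub>3} {\<^bold>F} {} {\<^bold>F} {\<^bold>T, \<^bold>t\<^sub>3}"
| "box_tv KD45 = case_tv {\<^bold>F} {\<^bold>F} {} {\<^bold>T} {\<^bold>F} {} {\<^bold>F} {\<^bold>T}"
| "box_tv KT = case_tv {\<^bold>F} {\<^bold>F, \<^bold>f} {} {} {} {} {\<^bold>F, \<^bold>f} {\<^bold>T, \<^bold>t}"
| "box_tv KTB = case_tv {\<^bold>F} {\<^bold>F} {} {} {} {} {\<^bold>F, \<^bold>f} {\<^bold>T, \<^bold>t}"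
| "box_tv S4 = case_tv {\<^bold>F} {\<^bold>F, \<^bold>f} {} {} {} {} {\<^bold>F, \<^bold>f} {\<^bold>T}"
| "box_tv S5 = case_tv {\<^bold>F} {\<^bold>F} {} {} {} {} {\<^bold>F} {\<^bold>T}"

section \<open>Partial valuations and models\<close>

text \<open>
  A map with domain \<open>\<Lambda>\<close> is a HOL function fixed to \<^const>\<open>undefined\<close> outside \<open>\<Lambda>\<close>.
\<close>

definition partial_valuations :: "modal_logic \<Rightarrow> 'p fm set \<Rightarrow> ('p fm \<Rightarrow> tv) set" where
  "partial_valuations L \<Lambda> = {v \<in> \<Lambda> \<rightarrow>\<^sub>E values_of L.
     (\<^bold>\<bottom> \<in> \<Lambda> \<longrightarrow> v \<^bold>\<bottom> \<in> fls_tv) \<and>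
     (\<forall>\<beta> \<gamma>. \<beta> \<^bold>\<rightarrow> \<gamma> \<in> \<Lambda> \<longrightarrow> v (\<beta> \<^bold>\<rightarrow> \<gamma>) \<in> imp_tv (v \<beta>) (v \<gamma>)) \<and>
     (\<forall>\<beta>. \<^bold>\<box> \<beta> \<in> \<Lambda> \<longrightarrow> v (\<^bold>\<box> \<beta>) \<in> box_tv L (v \<beta>))}"

definition pre_model ::
    "modal_logic \<Rightarrow> 'p fm set \<Rightarrow> ('p fm \<Rightarrow> tv) set \<Rightarrow> ('p fm \<Rightarrow> tv) rel \<Rightarrow> bool" where
  "pre_model L \<Lambda> W R \<longleftrightarrow>
     W \<subseteq> partial_valuations L \<Lambda> \<and> R \<subseteq> W \<times> W \<and>
     (\<forall>v\<in>W. \<forall>\<beta>\<in>\<Lambda>.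
        (v \<beta> \<in> tvP \<longrightarrow> (\<exists>w\<in>W. (v, w) \<in> R \<and> w \<beta> \<in> tvD)) \<and>
        (v \<beta> \<in> tvPN \<longrightarrow> (\<exists>w\<in>W. (v, w) \<in> R \<and> w \<beta> \<notin> tvD)))"

text \<open>
  The logic argument only determines which valuations are admitted; the relational condition
  is the one for \<^const>\<open>K\<close>.
\<close>

definition K_model ::
    "modal_logic \<Rightarrow> 'p fm set \<Rightarrow> ('p fm \<Rightarrow> tv) set \<Rightarrow> ('p fm \<Rightarrow> tv) rel \<Rightarrow> bool" where
  "K_model L \<Lambda> W R \<longleftrightarrow>
     pre_model L \<Lambda> W R \<and>
     (\<forall>v w. (v, w) \<in> R \<longrightarrow>
        (\<forall>\<beta>\<in>\<Lambda>. (v \<beta> \<in> tvN \<longrightarrow> w \<beta> \<in> tvD) \<and> (v \<beta> \<in> tvI \<longrightarrow> w \<beta> \<notin> tvD)))"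

fun scheme_cond ::
    "scheme \<Rightarrow> 'p fm set \<Rightarrow> ('p fm \<Rightarrow> tv) set \<Rightarrow> ('p fm \<Rightarrow> tv) rel \<Rightarrow> bool" where
  "scheme_cond Ax_T \<Lambda> W R \<longleftrightarrow>
     (\<forall>v\<in>W. \<forall>\<beta>\<in>\<Lambda>. (v \<beta> \<in> tvN \<longrightarrow> v \<beta> \<in> tvD) \<and> (v \<beta> \<in> tvI \<longrightarrow> v \<beta> \<notin> tvD))"
| "scheme_cond Ax_D \<Lambda> W R \<longleftrightarrow>
     (\<forall>v\<in>W. \<forall>\<beta>\<in>\<Lambda>. (v \<beta> \<in> tvN \<longrightarrow> v \<beta> \<in> tvP) \<and> (v \<beta> \<in> tvI \<longrightarrow> v \<beta> \<in> tvPN))"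
| "scheme_cond Ax_B \<Lambda> W R \<longleftrightarrow>
     (\<forall>v\<in>W. \<forall>w\<in>W. \<forall>\<beta>\<in>\<Lambda>. (v, w) \<in> R \<longrightarrow>
        (v \<beta> \<in> tvD \<longrightarrow> w \<beta> \<in> tvP) \<and> (v \<beta> \<notin> tvD \<longrightarrow> w \<beta> \<in> tvPN))"
| "scheme_cond Ax_4 \<Lambda> W R \<longleftrightarrow>
     (\<forall>v\<in>W. \<forall>w\<in>W. \<forall>\<beta>\<in>\<Lambda>. (v, w) \<in> R \<longrightarrow>
        (v \<beta> \<in> tvN \<longrightarrow> w \<beta> \<in> tvN) \<and> (v \<beta> \<in> tvI \<longrightarrow> w \<beta> \<in> tvI))"
| "scheme_cond Ax_5 \<Lambda> W R \<longleftrightarrow>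
     (\<forall>v\<in>W. \<forall>w\<in>W. \<forall>\<beta>\<in>\<Lambda>. (v, w) \<in> R \<longrightarrow>
        (v \<beta> \<in> tvP \<longrightarrow> w \<beta> \<in> tvP) \<and> (v \<beta> \<in> tvPN \<longrightarrow> w \<beta> \<in> tvPN)) \<and>
     (\<forall>v\<in>W. \<forall>w\<in>W. \<forall>w'\<in>W. \<forall>\<beta>\<in>\<Lambda>.
        (v, w) \<in> R \<and> ((v, w') \<in> R \<or> (w, w') \<in> R) \<longrightarrow>
        (v \<beta> \<in> tvN \<and> w \<beta> \<in> tvN \<longrightarrow> w' \<beta> \<in> tvN) \<and>
        (v \<beta> \<in> tvI \<and> w \<beta> \<in> tvI \<longrightarrow> w' \<beta> \<in> tvI))"

text \<open>
  The conditions are imposed for every scheme whose instances are theorems of the logic, not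
  only for the axioms in \<^const>\<open>schemes\<close>; for instance (D) is imposed for \<^const>\<open>KT\<close>.
\<close>

definition L_model ::
    "modal_logic \<Rightarrow> 'p fm set \<Rightarrow> ('p fm \<Rightarrow> tv) set \<Rightarrow> ('p fm \<Rightarrow> tv) rel \<Rightarrow> bool" where
  "L_model L \<Lambda> W R \<longleftrightarrow>
     K_model L \<Lambda> W R \<and>
     (\<forall>X. (\<forall>\<alpha> :: 'p fm. provable L (scheme_inst X \<alpha>)) \<longrightarrow> scheme_cond X \<Lambda> W R)"

definition partial_level_valuation ::
    "modal_logic \<Rightarrow> 'p fm set \<Rightarrow> ('p fm \<Rightarrow> tv) \<Rightarrow> bool" where
  "partial_level_valuation L \<Lambda> v \<longleftrightarrow> (\<exists>W R. L_model L \<Lambda> W R \<and> v \<in> W)"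

definition consequence :: "'p fm set \<Rightarrow> modal_logic \<Rightarrow> 'p fm \<Rightarrow> bool"
    (\<open>_ \<Turnstile>\<^bsup>_\<^esup> _\<close> [51, 0, 51] 50) where
  "\<Gamma> \<Turnstile>\<^bsup>L\<^esup> \<alpha> \<longleftrightarrow>
     (\<forall>v. partial_level_valuation L (subfm_closed hull (\<Gamma> \<union> {\<alpha>})) v \<longrightarrow>
        (\<forall>\<beta>\<in>\<Gamma>. v \<beta> \<in> tvD) \<longrightarrow> v \<alpha> \<in> tvD)"

end

(*
  An L-model (W, R) is turned into a Kripke model on the worlds W in which a formula of the
  domain is true exactly where its value is designated; Kripke soundness then finishes.  The
  tables make box b designated iff b takes a value in N, so the truth lemma holds for every
  relation S on W with R \<subseteq> S such that (v, w) \<in> S only if w designates every formula whose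
  v-value is in N.  R itself need not satisfy the frame conditions of L, and S is chosen
  large enough to restore them.
*)
theory Submission
  imports Defs
begin

section \<open>Kripke semantics\<close>

primrec sat :: "'w rel \<Rightarrow> ('w \<Rightarrow> 'p \<Rightarrow> bool) \<Rightarrow> 'w \<Rightarrow> 'p fm \<Rightarrow> bool" where
  "sat S V v (Var p) \<longleftrightarrow> V v p"
| "sat S V v \<^bold>\<bottom> \<longleftrightarrow> False"
| "sat S V v (\<alpha> \<^bold>\<rightarrow> \<beta>) \<longleftrightarrow> (sat S V v \<alpha> \<longrightarrow> sat S V v \<beta>)"
| "sat S V v (\<^bold>\<box> \<alpha>) \<longleftrightarrow> (\<forall>w. (v, w) \<in> S \<longrightarrow> sat S V w \<alpha>)"

text \<open>Seriality and reflexivity are confined to the worlds \<open>W\<close>, as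
  \<open>S\<close> lives on a whole type; the other conditions only concern pairs in
  \<open>S\<close>.\<close>

fun frame_cond :: "scheme \<Rightarrow> 'w set \<Rightarrow> 'w rel \<Rightarrow> bool" where
  "frame_cond Ax_D W S \<longleftrightarrow> (\<forall>v\<in>W. \<exists>w. (v, w) \<in> S)"
| "frame_cond Ax_T W S \<longleftrightarrow> (\<forall>v\<in>W. (v, v) \<in> S)"
| "frame_cond Ax_B W S \<longleftrightarrow> sym S"
| "frame_cond Ax_4 W S \<longleftrightarrow> trans S"
| "frame_cond Ax_5 W S \<longleftrightarrow> (\<forall>v w w'. (v, w) \<in> S \<and> (v, w') \<in> S \<longrightarrow> (w, w') \<in> S)"

lemma sat_scheme_inst:
  assumes "frame_cond X W S" "v \<in> W"
  shows "sat S V v (scheme_inst X \<alpha>)"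
proof (cases X)
  case Ax_D
  then show ?thesis using assms by auto
next
  case Ax_T
  then show ?thesis using assms by auto
next
  case Ax_B
  then show ?thesis using assms by (auto dest: symD)
next
  case Ax_4
  then show ?thesis using assms by (auto simp: trans_def)
next
  case Ax_5
  then have "(w, w') \<in> S" if "(v, w) \<in> S" "(v, w') \<in> S" for w w'
    using assms that unfolding Ax_5 frame_cond.simps by blast
  then show ?thesis unfolding Ax_5 scheme_inst.simps sat.simps by meson
qed

text \<open>The induction covers all worlds at once, so that necessitation goes through: successors
  stay in \<open>W\<close>.\<close>

lemma provable_imp_sat:
  assumes "provable L \<alpha>" "S \<subseteq> W \<times> W" "\<And>X. X \<in> schemes L \<Longrightarrow> frame_cond X W S" "v \<in> W"
  shows "sat S V v \<alpha>"
  using assms(1,4)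
proof (induction arbitrary: v)
  case (ax X \<alpha>)
  show ?case by (rule sat_scheme_inst[OF assms(3)[OF ax.hyps] ax.prems])
next
  case (nec \<alpha>)
  then show ?case using assms(2) by auto
qed simp_all

lemma sat_Conjs: "sat S V v (Conjs \<gamma>s) \<longleftrightarrow> (\<forall>\<gamma>\<in>set \<gamma>s. sat S V v \<gamma>)"
  by (induction \<gamma>s rule: Conjs.induct) auto

section \<open>Designated values\<close>

lemmas tv_sets = tvD_def tvN_def tvI_def tvP_def tvPN_def

text \<open>Reduces clauses about \<open>tvPN\<close> to \<open>tvN\<close>: failing to be necessary
  yields a refuting successor, and (B) and (5) become inclusions between sets of necessary
  formulas.\<close>

lemma tvPN_iff: "x \<in> tvPN \<longleftrightarrow> x \<notin> tvN"
  by (cases x) (simp_all add: tv_sets)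

text \<open>The table is nondeterministic, but each entry lies wholly inside or wholly outside
  \<open>tvD\<close>, following the classical truth table.\<close>

lemma imp_tv_designated:
  assumes "z \<in> imp_tv x y"
  shows "z \<in> tvD \<longleftrightarrow> (x \<in> tvD \<longrightarrow> y \<in> tvD)"
  using assms by (cases x; cases y) (auto simp: tv_sets)

lemma box_tv_designated:
  assumes "z \<in> box_tv L x"
  shows "z \<in> tvD \<longleftrightarrow> x \<in> tvN"
  using assms by (cases L; cases x) (auto simp: tv_sets)

lemma subfms_refl: "\<beta> \<in> subfms \<beta>"
  by (cases \<beta>) auto

lemma subfm_closedD:
  assumes "subfm_closed \<Lambda>"
  shows "\<beta> \<^bold>\<rightarrow> \<gamma> \<in> \<Lambda> \<Longrightarrow> \<beta> \<in> \<Lambda> \<and> \<gamma> \<in> \<Lambda>" "\<^bold>\<box> \<beta> \<in> \<Lambda> \<Longrightarrow> \<beta> \<in> \<Lambda>"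
  using assms subfms_refl unfolding subfm_closed_def by fastforce+

lemma truth_lemma:
  assumes model: "K_model L \<Lambda> W R" and closed: "subfm_closed \<Lambda>"
    and sub: "R \<subseteq> S" "S \<subseteq> W \<times> W"
    and step: "\<And>v w \<beta>. (v, w) \<in> S \<Longrightarrow> \<beta> \<in> \<Lambda> \<Longrightarrow> v \<beta> \<in> tvN \<Longrightarrow> w \<beta> \<in> tvD"
    and "\<beta> \<in> \<Lambda>" "v \<in> W"
  shows "sat S (\<lambda>w p. w (Var p) \<in> tvD) v \<beta> \<longleftrightarrow> v \<beta> \<in> tvD"
  using assms(6,7)
proof (induction \<beta> arbitrary: v)
  case Fls
  then have "v \<^bold>\<bottom> \<in> fls_tv"
    using model by (auto simp: K_model_def pre_model_def partial_valuations_def)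
  then show ?case by (auto simp: fls_tv_def tvD_def)
next
  case (Imp \<beta> \<gamma>)
  then have "v (\<beta> \<^bold>\<rightarrow> \<gamma>) \<in> imp_tv (v \<beta>) (v \<gamma>)"
    using model by (auto simp: K_model_def pre_model_def partial_valuations_def)
  moreover have "\<beta> \<in> \<Lambda>" "\<gamma> \<in> \<Lambda>"
    using Imp.prems(1) subfm_closedD(1)[OF closed] by blast+
  ultimately show ?case
    using Imp.IH Imp.prems(2) by (simp add: imp_tv_designated)
next
  case (Box \<beta>)
  then have "v (\<^bold>\<box> \<beta>) \<in> box_tv L (v \<beta>)"
    using model by (auto simp: K_model_def pre_model_def partial_valuations_def)
  then have box: "v (\<^bold>\<box> \<beta>) \<in> tvD \<longleftrightarrow> v \<beta> \<in> tvN"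
    by (rule box_tv_designated)
  have \<beta>: "\<beta> \<in> \<Lambda>"
    using Box.prems(1) subfm_closedD[OF closed] by blast
  \<comment> \<open>This \<open>R\<close>-successor is also an \<open>S\<close>-successor and
    refutes the box; \<open>step\<close> gives the converse direction.\<close>
  have "\<exists>w\<in>W. (v, w) \<in> R \<and> w \<beta> \<notin> tvD" if "v \<beta> \<notin> tvN"
    using that model \<beta> Box.prems(2) by (auto simp: K_model_def pre_model_def tvPN_iff)
  then show ?case
    unfolding box sat.simps using \<beta> Box.IH step sub by blast
qed simp

section \<open>The accessibility relation\<close>

text \<open>Stands in for the formulas whose box holds at \<open>v\<close>; it is read off the value
  of the formula itself because its box may lie outside \<open>\<Lambda>\<close>.\<close>

definition necessary :: "'p fm set \<Rightarrow> ('p fm \<Rightarrow> tv) \<Rightarrow> 'p fm set" where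
  "necessary \<Lambda> v = {\<beta> \<in> \<Lambda>. v \<beta> \<in> tvN}"

definition designated :: "'p fm set \<Rightarrow> ('p fm \<Rightarrow> tv) \<Rightarrow> 'p fm set" where
  "designated \<Lambda> v = {\<beta> \<in> \<Lambda>. v \<beta> \<in> tvD}"

text \<open>
  With (5) but without (4), \<open>R\<close> preserves the set of necessary formulas only at points that have
  a predecessor; from the other points no arrows are added.
\<close>

definition access ::
    "scheme set \<Rightarrow> 'p fm set \<Rightarrow> ('p fm \<Rightarrow> tv) set \<Rightarrow> ('p fm \<Rightarrow> tv) rel \<Rightarrow> ('p fm \<Rightarrow> tv) rel" where
  "access A \<Lambda> W R = {(v, w) \<in> W \<times> W.
     necessary \<Lambda> v \<subseteq> designated \<Lambda> w \<and>
     (Ax_B \<in> A \<longrightarrow> necessary \<Lambda> w \<subseteq> designated \<Lambda> v) \<and>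
     (Ax_4 \<in> A \<longrightarrow> necessary \<Lambda> v \<subseteq> necessary \<Lambda> w) \<and>
     (Ax_5 \<in> A \<longrightarrow>
        (if Ax_4 \<in> A then necessary \<Lambda> w = necessary \<Lambda> v
         else w \<in> Range R \<and>
           (if v \<in> Range R then necessary \<Lambda> w = necessary \<Lambda> v else (v, w) \<in> R)))}"

context
  fixes L :: modal_logic and \<Lambda> :: "'p fm set" and W :: "('p fm \<Rightarrow> tv) set"
    and R :: "('p fm \<Rightarrow> tv) rel"
  assumes model: "L_model L \<Lambda> W R"
begin

section \<open>Inclusions between necessary and designated sets along \<open>R\<close>\<close>

lemma model_K: "K_model L \<Lambda> W R"
  using model by (simp add: L_model_def)

lemma model_scheme_cond: "X \<in> schemes L \<Longrightarrow> scheme_cond X \<Lambda> W R"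
  using model unfolding L_model_def by (blast intro: provable.ax)

lemma model_rel_subset: "(v, w) \<in> R \<Longrightarrow> v \<in> W \<and> w \<in> W"
  using model_K by (auto simp: K_model_def pre_model_def)

lemma necessary_subset_designated: "(v, w) \<in> R \<Longrightarrow> necessary \<Lambda> v \<subseteq> designated \<Lambda> w"
  using model_K by (auto simp: K_model_def necessary_def designated_def)

text \<open>Contraposition of (B): a formula undesignated at \<open>v\<close> has a value in
  \<open>tvPN\<close> at \<open>w\<close>, so it is not necessary there.\<close>

lemma necessary_designated_B:
  "Ax_B \<in> schemes L \<Longrightarrow> (v, w) \<in> R \<Longrightarrow> necessary \<Lambda> w \<subseteq> designated \<Lambda> v"
  using model_scheme_cond[of Ax_B] model_rel_subset
  by (force simp: necessary_def designated_def tvPN_iff)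

lemma necessary_mono_4:
  "Ax_4 \<in> schemes L \<Longrightarrow> (v, w) \<in> R \<Longrightarrow> necessary \<Lambda> v \<subseteq> necessary \<Lambda> w"
  using model_scheme_cond[of Ax_4] model_rel_subset
  by (force simp: necessary_def)

lemma necessary_antimono_5:
  assumes "Ax_5 \<in> schemes L" "(v, w) \<in> R"
  shows "necessary \<Lambda> w \<subseteq> necessary \<Lambda> v"
  using model_scheme_cond[OF assms(1), unfolded scheme_cond.simps, THEN conjunct1, rule_format, of v w]
    assms(2) model_rel_subset[OF assms(2)]
  by (auto simp: necessary_def tvPN_iff)

text \<open>Necessity at \<open>w\<close> pulls back to \<open>v\<close>; the second clause of (5)
  then pushes it to \<open>w'\<close>.\<close>

lemma necessary_siblings_5:
  assumes "Ax_5 \<in> schemes L" "(v, w) \<in> R" "(v, w') \<in> R \<or> (w, w') \<in> R"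
  shows "necessary \<Lambda> w \<subseteq> necessary \<Lambda> w'"
proof
  fix \<beta> assume \<beta>: "\<beta> \<in> necessary \<Lambda> w"
  then have "\<beta> \<in> necessary \<Lambda> v"
    using necessary_antimono_5 assms by blast
  moreover have "v \<in> W" "w \<in> W" "w' \<in> W"
    using assms model_rel_subset by blast+
  ultimately show "\<beta> \<in> necessary \<Lambda> w'"
    using \<beta> assms(2,3)
      model_scheme_cond[OF assms(1), unfolded scheme_cond.simps, THEN conjunct2, rule_format, of v w w' \<beta>]
    by (simp add: necessary_def)
qed

lemma rel_subset_access: "R \<subseteq> access (schemes L) \<Lambda> W R"
proof (rule subrelI)
  fix v w assume vw: "(v, w) \<in> R"
  have "necessary \<Lambda> w = necessary \<Lambda> v" if "Ax_5 \<in> schemes L" "Ax_4 \<in> schemes L"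
    using that vw necessary_mono_4 necessary_antimono_5 by blast
  \<comment> \<open>For a predecessor \<open>u\<close> of \<open>v\<close>, the chain
    \<open>u\<close>, \<open>v\<close>, \<open>w\<close> gives one inclusion and antimonotonicity
    the other.\<close>
  moreover have "necessary \<Lambda> w = necessary \<Lambda> v" if "Ax_5 \<in> schemes L" "v \<in> Range R"
    using that vw necessary_siblings_5 necessary_antimono_5 by blast
  ultimately show "(v, w) \<in> access (schemes L) \<Lambda> W R"
    using vw model_rel_subset[OF vw] necessary_subset_designated[OF vw]
      necessary_designated_B[OF _ vw] necessary_mono_4[OF _ vw]
    by (simp add: access_def Range.intros)
qed

section \<open>Frame conditions of the enlarged relation\<close>

lemma frame_cond_D:
  assumes "Ax_D \<in> schemes L" "\<Lambda> \<noteq> {}"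
  shows "frame_cond Ax_D W (access (schemes L) \<Lambda> W R)"
proof -
  have "\<exists>w. (v, w) \<in> R" if v: "v \<in> W" for v
  proof -
    \<comment> \<open>Successors come only from witness clauses, so some formula is required: its
      value is in \<open>tvPN\<close>, or in \<open>tvN\<close> and then by (D) in
      \<open>tvP\<close>.\<close>
    obtain \<beta> where \<beta>: "\<beta> \<in> \<Lambda>" using assms(2) by blast
    then have "v \<beta> \<in> tvP \<or> v \<beta> \<in> tvPN"
      using model_scheme_cond[OF assms(1)] v by (auto simp: tvPN_iff)
    then show ?thesis
      using model_K \<beta> v unfolding K_model_def pre_model_def by blast
  qed
  then show ?thesis using rel_subset_access by (meson frame_cond.simps(1) subsetD)
qed

lemma frame_cond_T:
  assumes "Ax_T \<in> schemes L"
  shows "frame_cond Ax_T W (access (schemes L) \<Lambda> W R)"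
proof -
  have "necessary \<Lambda> v \<subseteq> designated \<Lambda> v" if "v \<in> W" for v
    using that model_scheme_cond[OF assms] by (auto simp: necessary_def designated_def)
  \<comment> \<open>Among the logics with (T) only \<open>S5\<close> has (5), so the clause
    mentioning \<open>Range R\<close> does not arise.\<close>
  moreover have "Ax_5 \<in> schemes L \<Longrightarrow> Ax_4 \<in> schemes L"
    using assms by (cases L) auto
  ultimately show ?thesis by (auto simp: access_def)
qed

lemma frame_cond_B:
  assumes "Ax_B \<in> schemes L"
  shows "frame_cond Ax_B W (access (schemes L) \<Lambda> W R)"
proof -
  \<comment> \<open>Either only the two mutually converse inclusions remain, or equality of
    necessary sets is added; both are symmetric.\<close>
  have "Ax_4 \<in> schemes L \<longleftrightarrow> Ax_5 \<in> schemes L"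
    using assms by (cases L) auto
  then show ?thesis by (auto simp: access_def sym_def assms)
qed

lemma frame_cond_4:
  assumes "Ax_4 \<in> schemes L"
  shows "frame_cond Ax_4 W (access (schemes L) \<Lambda> W R)"
proof -
  \<comment> \<open>With (B), the necessary sets are equal along arrows, so the backward inclusion
    composes too.\<close>
  have "Ax_B \<in> schemes L \<Longrightarrow> Ax_5 \<in> schemes L"
    using assms by (cases L) auto
  then show ?thesis
    using assms by (auto simp: access_def trans_def)
qed

lemma frame_cond_5:
  assumes "Ax_5 \<in> schemes L"
  shows "frame_cond Ax_5 W (access (schemes L) \<Lambda> W R)"
proof (cases "Ax_4 \<in> schemes L")
  case True
  then show ?thesis using assms by (auto simp: access_def)
next
  case False
  \<comment> \<open>Only \<open>K5\<close> and \<open>KD5\<close> remain. All targets lie in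
    \<open>Range R\<close>, so an arrow from \<open>w\<close> to \<open>w'\<close> needs equal
    necessary sets, and \<open>necessary \<Lambda> w \<subseteq> necessary \<Lambda> v \<subseteq>
    designated \<Lambda> w'\<close>.\<close>
  then have B: "Ax_B \<notin> schemes L" using assms by (cases L) auto
  have "(w, w') \<in> access (schemes L) \<Lambda> W R"
    if vw: "(v, w) \<in> access (schemes L) \<Lambda> W R" and vw': "(v, w') \<in> access (schemes L) \<Lambda> W R"
    for v w w'
  proof -
    have W: "w \<in> W" "w' \<in> W" "w \<in> Range R" "w' \<in> Range R"
      and D: "necessary \<Lambda> v \<subseteq> designated \<Lambda> w'"
      using vw vw' assms False by (auto simp: access_def)
    have "necessary \<Lambda> w \<subseteq> necessary \<Lambda> v \<and> necessary \<Lambda> w' = necessary \<Lambda> w"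
    proof (cases "v \<in> Range R")
      case True
      then show ?thesis using vw vw' assms False by (simp add: access_def)
    next
      case noRange: False
      \<comment> \<open>A point without predecessor has only its original arrows, so the sibling
        lemma applies in both directions.\<close>
      then have "(v, w) \<in> R" "(v, w') \<in> R"
        using vw vw' assms False by (simp_all add: access_def)
      then show ?thesis
        using assms necessary_antimono_5 necessary_siblings_5 by blast
    qed
    then show ?thesis
      using W D assms False B by (auto simp: access_def)
  qed
  then show ?thesis unfolding frame_cond.simps by blast
qed

lemma frame_cond_access:
  assumes "X \<in> schemes L" "\<Lambda> \<noteq> {}"
  shows "frame_cond X W (access (schemes L) \<Lambda> W R)"
  using assms frame_cond_D frame_cond_T frame_cond_B frame_cond_4 frame_cond_5
  by (cases X) blast+

lemma truth_lemma_access: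
  assumes "subfm_closed \<Lambda>" "\<beta> \<in> \<Lambda>" "v \<in> W"
  shows "sat (access (schemes L) \<Lambda> W R) (\<lambda>w p. w (Var p) \<in> tvD) v \<beta> \<longleftrightarrow> v \<beta> \<in> tvD"
  using model_K assms(1) rel_subset_access _ _ assms(2,3)
  by (rule truth_lemma) (auto simp: access_def necessary_def designated_def)

end

section \<open>Soundness of the consequence relation\<close>

lemma subfm_closed_hull: "subfm_closed (subfm_closed hull \<Delta>)"
  by (rule hull_in) (auto simp: subfm_closed_def)

theorem theorem5:
  fixes L :: modal_logic and \<Gamma> :: "'p fm set" and \<alpha> :: "'p fm"
  assumes "\<Gamma> \<turnstile>\<^bsub>L\<^esub> \<alpha>"
  shows "\<Gamma> \<Turnstile>\<^bsup>L\<^esup> \<alpha>"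
  unfolding consequence_def
proof (intro allI impI)
  fix v
  let ?\<Lambda> = "subfm_closed hull (\<Gamma> \<union> {\<alpha>})"
  assume "partial_level_valuation L ?\<Lambda> v" and \<Gamma>: "\<forall>\<beta>\<in>\<Gamma>. v \<beta> \<in> tvD"
  then obtain W R where model: "L_model L ?\<Lambda> W R" and v: "v \<in> W"
    by (auto simp: partial_level_valuation_def)
  let ?S = "access (schemes L) ?\<Lambda> W R"
  let ?sat = "sat ?S (\<lambda>w p. w (Var p) \<in> tvD) v"
  have \<Lambda>: "\<Gamma> \<union> {\<alpha>} \<subseteq> ?\<Lambda>" by (rule hull_subset)
  have sat: "?sat \<beta> \<longleftrightarrow> v \<beta> \<in> tvD" if "\<beta> \<in> \<Gamma> \<union> {\<alpha>}" for \<beta>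
    using truth_lemma_access[OF model subfm_closed_hull] that \<Lambda> v by blast
  \<comment> \<open>Derivations may leave \<open>?\<Lambda>\<close>; Kripke truth is defined for
    every formula, and values are compared only on
    \<open>\<Gamma> \<union> {\<alpha>}\<close>.\<close>
  have sound: "?sat \<beta>" if "provable L \<beta>" for \<beta>
  proof (rule provable_imp_sat[OF that _ _ v])
    show "?S \<subseteq> W \<times> W" by (auto simp: access_def)
    show "frame_cond X W ?S" if "X \<in> schemes L" for X
      using frame_cond_access[OF model that] \<Lambda> by blast
  qed
  from assms have "?sat \<alpha>"
    unfolding derivable_def
  proof (elim disjE exE conjE)
    fix \<gamma>s assume "set \<gamma>s \<subseteq> \<Gamma>" "provable L (Conjs \<gamma>s \<^bold>\<rightarrow> \<alpha>)"
    then show "?sat \<alpha>"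
      using sound[of "Conjs \<gamma>s \<^bold>\<rightarrow> \<alpha>"] sat \<Gamma> by (auto simp: sat_Conjs)
  qed (rule sound)
  then show "v \<alpha> \<in> tvD" using sat by simp
qed

end
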